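(* Let $K\ge1$ be an integer, $B>0$, and let $(X_n)_{n\ge0}$ be the nearest neighbour walk on $\{0,1,2,\dots\}$ with $p_i=\frac14\Lambda(K,i,B)$ (in the sense described in the context). Then the Markov chain $(X_n)$ is recurrent if $B\le1$ and transient if $B>1$.
   Context: Walk: for $0\le p_i<1/2$, $i\ge1$, $(X_n)_{n\ge0}$ is the Markov chain on $\{0,1,2,\dots\}$ with $X_0=0$ and $\mathbf P(X_{n+1}=i+1\mid X_n=i)=1-\mathbf P(X_{n+1}=i-1\mid X_n=i)=E_i$, where $E_0=1$ and $E_i=1/2+p_i$ for $i\ge1$. Iterated logarithms: $\log_0 i=i$, $\log_1 i=\log i$, $\log_k i=\log\log_{k-1}i$. Put $\lambda(0,i)=1$, $\lambda(1,i)=i$, $\lambda(k,i)=\lambda(k-1,i)\log_{k-1}i$ for $k\ge2$; $\Lambda(0,i)=0$, $\Lambda(K,i)=\sum_{k=1}^{K}\frac1{\lambda(k,i)}$, and $\Lambda(K,i,B)=\Lambda(K-1,i)+\frac{B}{\lambda(K,i)}$ for $B>0$. Convention: "$p_i=\frac14\Lambda(K,i,B)$" means the following. Let $i_0$ be the smallest positive integer $i$ such that $\log_{K-1}i$ is defined and positive and $\frac14\Lambda(K,i,B)<\frac12$; then $p_i=\frac14\Lambda(K,i,B)$ for $i\ge i_0$ and $p_i=p_{i_0}$ for $1\le i\le i_0$. *)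

theory Defs
  imports "HOL-Probability.Probability"
begin

text \<open>Iterated natural logarithms. Since \<open>ln\<close> is total, the predicate \<open>ilog_defined k x\<close>
  records that every logarithm occurring in \<open>ilog k x\<close> is taken of a positive number.\<close>

primrec ilog :: "nat \<Rightarrow> real \<Rightarrow> real" where
  "ilog 0 x = x"
| "ilog (Suc k) x = ln (ilog k x)"

primrec ilog_defined :: "nat \<Rightarrow> real \<Rightarrow> bool" where
  "ilog_defined 0 x = True"
| "ilog_defined (Suc k) x = (ilog_defined k x \<and> ilog k x > 0)"

fun lam :: "nat \<Rightarrow> real \<Rightarrow> real" where
  "lam 0 x = 1"
| "lam (Suc 0) x = x"
| "lam (Suc (Suc k)) x = lam (Suc k) x * ilog (Suc k) x"

definition Lam :: "nat \<Rightarrow> real \<Rightarrow> real" where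
  "Lam K x = (\<Sum>k=1..K. 1 / lam k x)"

text \<open>Intended for \<open>K \<ge> 1\<close>.\<close>

definition LamB :: "nat \<Rightarrow> real \<Rightarrow> real \<Rightarrow> real" where
  "LamB K x B = Lam (K - 1) x + B / lam K x"

definition start_index :: "nat \<Rightarrow> real \<Rightarrow> nat" where
  "start_index K B = (LEAST i. i \<ge> 1 \<and> ilog_defined (K - 1) (real i) \<and> ilog (K - 1) (real i) > 0
                              \<and> 1 / 4 * LamB K (real i) B < 1 / 2)"

definition iterlog_drift :: "nat \<Rightarrow> real \<Rightarrow> nat \<Rightarrow> real" where
  "iterlog_drift K B i = 1 / 4 * LamB K (real (max i (start_index K B))) B"

text \<open>A time-homogeneous Markov chain on the natural numbers, with transition
  probabilities \<open>P\<close>; the conditioning is on the whole past, whenever that has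
  positive probability.\<close>

definition markov_chain ::
  "'a measure \<Rightarrow> (nat \<Rightarrow> 'a \<Rightarrow> nat) \<Rightarrow> (nat \<Rightarrow> nat \<Rightarrow> real) \<Rightarrow> bool" where
  "markov_chain M X P \<longleftrightarrow>
     prob_space M \<and>
     (\<forall>n. X n \<in> measurable M (count_space UNIV)) \<and>
     (\<forall>n s j. \<P>(\<omega> in M. \<forall>k\<le>n. X k \<omega> = s k) > 0 \<longrightarrow>
        \<P>(\<omega> in M. X (Suc n) \<omega> = j \<bar> \<forall>k\<le>n. X k \<omega> = s k) = P (s n) j)"

definition up_prob :: "(nat \<Rightarrow> real) \<Rightarrow> nat \<Rightarrow> real" where
  "up_prob p i = (if i = 0 then 1 else 1 / 2 + p i)"

definition nn_transition :: "(nat \<Rightarrow> real) \<Rightarrow> nat \<Rightarrow> nat \<Rightarrow> real" where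
  "nn_transition p i j =
     (if j = Suc i then up_prob p i else if i = Suc j then 1 - up_prob p i else 0)"

definition nearest_neighbour_walk ::
  "(nat \<Rightarrow> real) \<Rightarrow> 'a measure \<Rightarrow> (nat \<Rightarrow> 'a \<Rightarrow> nat) \<Rightarrow> bool" where
  "nearest_neighbour_walk p M X \<longleftrightarrow>
     markov_chain M X (nn_transition p) \<and> (AE \<omega> in M. X 0 \<omega> = 0)"

text \<open>A state is recurrent (transient) if the chain, once it is there, returns to it with
  probability one (less than one). For a time-homogeneous chain the return probability
  does not depend on the time \<open>m\<close> at which the state is occupied. A state that is never
  visited by the process is neither, so that the notions are not vacuous.\<close>

definition visited_state :: "'a measure \<Rightarrow> (nat \<Rightarrow> 'a \<Rightarrow> nat) \<Rightarrow> nat \<Rightarrow> bool" where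
  "visited_state M X i \<longleftrightarrow> (\<exists>m. \<P>(\<omega> in M. X m \<omega> = i) > 0)"

definition recurrent_state :: "'a measure \<Rightarrow> (nat \<Rightarrow> 'a \<Rightarrow> nat) \<Rightarrow> nat \<Rightarrow> bool" where
  "recurrent_state M X i \<longleftrightarrow> visited_state M X i \<and>
     (\<forall>m. \<P>(\<omega> in M. X m \<omega> = i) > 0 \<longrightarrow>
        \<P>(\<omega> in M. \<exists>n>m. X n \<omega> = i \<bar> X m \<omega> = i) = 1)"

definition transient_state :: "'a measure \<Rightarrow> (nat \<Rightarrow> 'a \<Rightarrow> nat) \<Rightarrow> nat \<Rightarrow> bool" where
  "transient_state M X i \<longleftrightarrow> visited_state M X i \<and>
     (\<forall>m. \<P>(\<omega> in M. X m \<omega> = i) > 0 \<longrightarrow>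
        \<P>(\<omega> in M. \<exists>n>m. X n \<omega> = i \<bar> X m \<omega> = i) < 1)"

definition recurrent_chain :: "'a measure \<Rightarrow> (nat \<Rightarrow> 'a \<Rightarrow> nat) \<Rightarrow> bool" where
  "recurrent_chain M X \<longleftrightarrow> (\<forall>i. recurrent_state M X i)"

definition transient_chain :: "'a measure \<Rightarrow> (nat \<Rightarrow> 'a \<Rightarrow> nat) \<Rightarrow> bool" where
  "transient_chain M X \<longleftrightarrow> (\<forall>i. transient_state M X i)"

end

theory Submission
  imports Defs
begin

text \<open>For a nearest neighbour walk, the probability of avoiding a state \<open>i\<close> forever is governed by
  functions harmonic off \<open>i\<close>, whose increments above \<open>i\<close> are proportional to
  \<open>\<rho> n = (\<Prod>j=1..n. (1 - E j) / E j)\<close>; hence the walk is recurrent iff \<open>\<Sum>\<rho>\<close> diverges.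
  With \<open>y = \<Lambda>(K,j,B)/2\<close> the \<open>j\<close>-th factor is \<open>(1 - y)/(1 + y) = exp (-\<Lambda>(K,j,B) + O(1/j\<^sup>2))\<close>.
  As \<open>log\<^sub>k\<close> has derivative \<open>1/\<lambda>(k,x)\<close>, the function
  \<open>\<Phi> = log\<^sub>1 + \<dots> + log\<^bsub>K-1\<^esub> + B log\<^sub>K\<close> is a primitive of \<open>\<Lambda>(K,x,B)\<close>, so \<open>\<rho> n\<close> is comparable
  to \<open>exp (-\<Phi> n)\<close>. The latter has the primitive \<open>log\<^sub>K\<close>, unbounded, for \<open>B = 1\<close> and the bounded
  primitive \<open>-(log\<^bsub>K-1\<^esub>)\<^bsup>1-B\<^esup>/(B - 1)\<close> for \<open>B > 1\<close>.\<close>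

section \<open>Nearest neighbour walks\<close>

text \<open>\<open>avoid_prob p i n x\<close> is the probability that the walk from \<open>x\<close> is not at \<open>i\<close> at any of the times
  \<open>1, \<dots>, n\<close>. For \<open>x = 0\<close> the truncated \<open>x - 1\<close> does no harm, as its weight \<open>1 - up_prob p 0\<close> is \<open>0\<close>.\<close>

primrec avoid_prob :: "(nat \<Rightarrow> real) \<Rightarrow> nat \<Rightarrow> nat \<Rightarrow> nat \<Rightarrow> real" where
  "avoid_prob p i 0 x = 1"
| "avoid_prob p i (Suc n) x =
     up_prob p x * (if Suc x = i then 0 else avoid_prob p i n (Suc x)) +
     (1 - up_prob p x) * (if x - 1 = i then 0 else avoid_prob p i n (x - 1))"

section \<open>Path probabilities and the probability of return\<close>

lemma (in prob_space) sums_prob_values: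
  fixes Y :: "'a \<Rightarrow> nat"
  assumes [measurable]: "Y \<in> measurable M (count_space UNIV)" "Measurable.pred M Q"
  shows "(\<lambda>y. \<P>(\<omega> in M. Q \<omega> \<and> Y \<omega> = y)) sums \<P>(\<omega> in M. Q \<omega>)"
proof -
  have "(\<lambda>y. prob {\<omega>\<in>space M. Q \<omega> \<and> Y \<omega> = y}) sums prob (\<Union>y. {\<omega>\<in>space M. Q \<omega> \<and> Y \<omega> = y})"
    by (intro finite_measure_UNION) (auto simp: disjoint_family_on_def)
  also have "(\<Union>y. {\<omega>\<in>space M. Q \<omega> \<and> Y \<omega> = y}) = {\<omega>\<in>space M. Q \<omega>}"
    by auto
  finally show ?thesis .
qed

lemma markov_chain_measurable:
  "markov_chain M X P \<Longrightarrow> X n \<in> measurable M (count_space UNIV)"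
  by (simp add: markov_chain_def)

text \<open>Multiplying out the conditional probability removes the positivity condition: over a
  past of probability \<open>0\<close> both sides vanish.\<close>

lemma markov_chain_step:
  assumes mc: "markov_chain M X P"
  shows "\<P>(\<omega> in M. (\<forall>k\<le>n. X k \<omega> = s k) \<and> X (Suc n) \<omega> = j)
           = \<P>(\<omega> in M. \<forall>k\<le>n. X k \<omega> = s k) * P (s n) j"
proof -
  interpret prob_space M using mc by (simp add: markov_chain_def)
  note [measurable] = markov_chain_measurable[OF mc]
  show ?thesis
  proof (cases "\<P>(\<omega> in M. \<forall>k\<le>n. X k \<omega> = s k) > 0")
    case True
    then have "\<P>(\<omega> in M. X (Suc n) \<omega> = j \<bar> \<forall>k\<le>n. X k \<omega> = s k) = P (s n) j"
      using mc by (auto simp: markov_chain_def)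
    with True show ?thesis
      by (simp add: cond_prob_def field_simps conj_commute)
  next
    case False
    then have z: "\<P>(\<omega> in M. \<forall>k\<le>n. X k \<omega> = s k) = 0"
      by (simp add: not_less measure_le_0_iff)
    have "\<P>(\<omega> in M. (\<forall>k\<le>n. X k \<omega> = s k) \<and> X (Suc n) \<omega> = j)
            \<le> \<P>(\<omega> in M. \<forall>k\<le>n. X k \<omega> = s k)"
      by (intro finite_measure_mono) auto
    with z have "\<P>(\<omega> in M. (\<forall>k\<le>n. X k \<omega> = s k) \<and> X (Suc n) \<omega> = j) = 0"
      by (simp only: measure_le_0_iff)
    with z show ?thesis by simp
  qed
qed

text \<open>First-step decomposition. Since \<open>markov_chain\<close> conditions on the whole
  past, the induction carries a fully prescribed path and lengthens it by the next position
  \<open>y\<close>.\<close>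

lemma prob_path_avoid:
  assumes mc: "markov_chain M X (nn_transition p)"
  shows "\<P>(\<omega> in M. (\<forall>k\<le>m. X k \<omega> = s k) \<and> (\<forall>j\<in>{m<..m+n}. X j \<omega> \<noteq> i))
           = \<P>(\<omega> in M. \<forall>k\<le>m. X k \<omega> = s k) * avoid_prob p i n (s m)"
proof (induction n arbitrary: m s)
  case 0
  show ?case by simp
next
  case (Suc n)
  interpret prob_space M using mc by (simp add: markov_chain_def)
  note [measurable] = markov_chain_measurable[OF mc]
  let ?Q = "\<lambda>\<omega>. (\<forall>k\<le>m. X k \<omega> = s k) \<and> (\<forall>j\<in>{m<..m+Suc n}. X j \<omega> \<noteq> i)"
  let ?p = "\<P>(\<omega> in M. \<forall>k\<le>m. X k \<omega> = s k)"
  let ?g = "\<lambda>y. nn_transition p (s m) y * (if y = i then 0 else avoid_prob p i n y)"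
  have split: "\<P>(\<omega> in M. ?Q \<omega> \<and> X (Suc m) \<omega> = y) = ?p * ?g y" for y
  proof (cases "y = i")
    case True
    then have "{\<omega>\<in>space M. ?Q \<omega> \<and> X (Suc m) \<omega> = y} = {}"
      by auto
    then show ?thesis using True by (simp only: measure_empty) simp
  next
    case False
    let ?s = "s(Suc m := y)"
    have path: "(\<forall>k\<le>Suc m. X k \<omega> = ?s k) \<longleftrightarrow> (\<forall>k\<le>m. X k \<omega> = s k) \<and> X (Suc m) \<omega> = y" for \<omega>
      by (auto simp: le_Suc_eq)
    have "{m<..m + Suc n} = insert (Suc m) {Suc m<..Suc m + n}" by auto
    then have "\<P>(\<omega> in M. ?Q \<omega> \<and> X (Suc m) \<omega> = y)
        = \<P>(\<omega> in M. (\<forall>k\<le>Suc m. X k \<omega> = ?s k) \<and> (\<forall>j\<in>{Suc m<..Suc m+n}. X j \<omega> \<noteq> i))"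
      unfolding path using False by (intro arg_cong[where f=prob]) auto
    also have "\<dots> = \<P>(\<omega> in M. \<forall>k\<le>Suc m. X k \<omega> = ?s k) * avoid_prob p i n y"
      using Suc.IH[of "Suc m" ?s] by (simp only: fun_upd_same)
    also have "\<P>(\<omega> in M. \<forall>k\<le>Suc m. X k \<omega> = ?s k) = ?p * nn_transition p (s m) y"
      unfolding path by (rule markov_chain_step[OF mc])
    finally show ?thesis using False by simp
  qed
  have "(\<lambda>y. \<P>(\<omega> in M. ?Q \<omega> \<and> X (Suc m) \<omega> = y)) sums \<P>(\<omega> in M. ?Q \<omega>)"
    by (rule sums_prob_values) measurable
  then have "(\<lambda>y. ?p * ?g y) sums \<P>(\<omega> in M. ?Q \<omega>)"
    unfolding split .
  \<comment> \<open>Only neighbours contribute. For \<open>s m = 0\<close> the second index is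
    \<open>0\<close> itself; its transition weight vanishes, in agreement with the coefficient
    \<open>1 - up_prob p 0 = 0\<close>.\<close>
  moreover have "(\<lambda>y. ?p * ?g y) sums (\<Sum>y\<in>{Suc (s m), s m - 1}. ?p * ?g y)"
    by (rule sums_finite) (auto simp: nn_transition_def)
  ultimately have "\<P>(\<omega> in M. ?Q \<omega>) = (\<Sum>y\<in>{Suc (s m), s m - 1}. ?p * ?g y)"
    by (rule sums_unique2)
  also have "\<dots> = ?p * avoid_prob p i (Suc n) (s m)"
    by (cases "s m") (auto simp: nn_transition_def up_prob_def algebra_simps)
  finally show ?case .
qed

text \<open>Return probabilities condition on the position at time \<open>m\<close> alone, so the
  past before \<open>m\<close> has to be summed out. The factor is the same for every past.\<close>

lemma prob_avoid:
  assumes mc: "markov_chain M X (nn_transition p)"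
  shows "\<P>(\<omega> in M. X m \<omega> = i \<and> (\<forall>j\<in>{m<..m+n}. X j \<omega> \<noteq> i))
           = \<P>(\<omega> in M. X m \<omega> = i) * avoid_prob p i n i"
proof -
  interpret prob_space M using mc by (simp add: markov_chain_def)
  note [measurable] = markov_chain_measurable[OF mc]
  let ?A = "\<lambda>\<omega>. \<forall>j\<in>{m<..m+n}. X j \<omega> \<noteq> i"
  \<comment> \<open>The first \<open>m\<close> positions are released one at a time, from the last to the first.\<close>
  have "\<P>(\<omega> in M. (\<forall>k<l. X k \<omega> = s k) \<and> X m \<omega> = i \<and> ?A \<omega>)
          = \<P>(\<omega> in M. (\<forall>k<l. X k \<omega> = s k) \<and> X m \<omega> = i) * avoid_prob p i n i"
    if "l \<le> m" for l s
    using that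
  proof (induction l arbitrary: s rule: inc_induct)
    case base
    have past: "(\<forall>k<m. X k \<omega> = s k) \<and> X m \<omega> = i \<longleftrightarrow> (\<forall>k\<le>m. X k \<omega> = (s(m := i)) k)" for \<omega>
      by (auto simp: le_less)
    then have "(\<forall>k<m. X k \<omega> = s k) \<and> X m \<omega> = i \<and> ?A \<omega>
        \<longleftrightarrow> (\<forall>k\<le>m. X k \<omega> = (s(m := i)) k) \<and> ?A \<omega>" for \<omega>
      by blast
    with past show ?case
      using prob_path_avoid[OF mc, of m "s(m := i)" n i] by (simp only: fun_upd_same)
  next
    case (step l)
    let ?R = "\<lambda>\<omega>. (\<forall>k<l. X k \<omega> = s k) \<and> X m \<omega> = i"
    let ?s = "\<lambda>y. s(l := y)"
    have path: "(\<forall>k<Suc l. X k \<omega> = ?s y k) \<longleftrightarrow> (\<forall>k<l. X k \<omega> = s k) \<and> X l \<omega> = y" for \<omega> y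
      by (auto simp: less_Suc_eq)
    have eq: "\<P>(\<omega> in M. (?R \<omega> \<and> ?A \<omega>) \<and> X l \<omega> = y)
        = \<P>(\<omega> in M. ?R \<omega> \<and> X l \<omega> = y) * avoid_prob p i n i" for y
    proof -
      have "?R \<omega> \<and> X l \<omega> = y \<longleftrightarrow> (\<forall>k<Suc l. X k \<omega> = ?s y k) \<and> X m \<omega> = i"
        "(?R \<omega> \<and> ?A \<omega>) \<and> X l \<omega> = y \<longleftrightarrow> (\<forall>k<Suc l. X k \<omega> = ?s y k) \<and> X m \<omega> = i \<and> ?A \<omega>" for \<omega>
        unfolding path by blast+
      then show ?thesis
        using step.IH[of "?s y"] by (simp only:)
    qed
    have "(\<lambda>y. \<P>(\<omega> in M. (?R \<omega> \<and> ?A \<omega>) \<and> X l \<omega> = y)) sums \<P>(\<omega> in M. ?R \<omega> \<and> ?A \<omega>)"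
      by (rule sums_prob_values) measurable
    then have "(\<lambda>y. \<P>(\<omega> in M. ?R \<omega> \<and> X l \<omega> = y) * avoid_prob p i n i) sums \<P>(\<omega> in M. ?R \<omega> \<and> ?A \<omega>)"
      unfolding eq .
    moreover have "(\<lambda>y. \<P>(\<omega> in M. ?R \<omega> \<and> X l \<omega> = y) * avoid_prob p i n i)
        sums (\<P>(\<omega> in M. ?R \<omega>) * avoid_prob p i n i)"
      by (intro sums_mult2 sums_prob_values) measurable
    ultimately have "\<P>(\<omega> in M. ?R \<omega> \<and> ?A \<omega>) = \<P>(\<omega> in M. ?R \<omega>) * avoid_prob p i n i"
      by (rule sums_unique2)
    then show ?case
      by (simp only: conj_assoc)
  qed
  from this[of 0] show ?thesis by simp
qed

text \<open>Never returning is the decreasing intersection of avoiding \<open>i\<close> on finite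
  windows, so continuity from above gives its probability; the return event is the complement within
  \<open>X m = i\<close>.\<close>

lemma return_prob:
  assumes mc: "markov_chain M X (nn_transition p)"
    and pos: "\<P>(\<omega> in M. X m \<omega> = i) > 0"
    and lim: "(\<lambda>n. avoid_prob p i n i) \<longlonglongrightarrow> r"
  shows "\<P>(\<omega> in M. \<exists>n>m. X n \<omega> = i \<bar> X m \<omega> = i) = 1 - r"
proof -
  interpret prob_space M using mc by (simp add: markov_chain_def)
  note [measurable] = markov_chain_measurable[OF mc]
  let ?p = "\<P>(\<omega> in M. X m \<omega> = i)"
  let ?A = "\<lambda>n. {\<omega>\<in>space M. X m \<omega> = i \<and> (\<forall>j\<in>{m<..m+n}. X j \<omega> \<noteq> i)}"
  have "(\<lambda>n. prob (?A n)) \<longlonglongrightarrow> prob (\<Inter>n. ?A n)"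
    by (intro finite_Lim_measure_decseq) (auto simp: decseq_def)
  moreover have "(\<lambda>n. prob (?A n)) \<longlonglongrightarrow> ?p * r"
    unfolding prob_avoid[OF mc] by (intro tendsto_mult_left lim)
  ultimately have never: "prob (\<Inter>n. ?A n) = ?p * r"
    by (rule LIMSEQ_unique)
  have "(\<Inter>n. ?A n) = {\<omega>\<in>space M. X m \<omega> = i \<and> (\<forall>n>m. X n \<omega> \<noteq> i)}"
  proof -
    have "j \<in> {m<..m + j}" if "j > m" for j using that by simp
    then show ?thesis by fastforce
  qed
  with never have "?p * r = \<P>(\<omega> in M. X m \<omega> = i \<and> (\<forall>n>m. X n \<omega> \<noteq> i))"
    by simp
  moreover have "?p = \<P>(\<omega> in M. (\<exists>n>m. X n \<omega> = i) \<and> X m \<omega> = i)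
      + \<P>(\<omega> in M. X m \<omega> = i \<and> (\<forall>n>m. X n \<omega> \<noteq> i))"
  proof -
    have "{\<omega>\<in>space M. X m \<omega> = i} = {\<omega>\<in>space M. (\<exists>n>m. X n \<omega> = i) \<and> X m \<omega> = i}
        \<union> {\<omega>\<in>space M. X m \<omega> = i \<and> (\<forall>n>m. X n \<omega> \<noteq> i)}"
      by blast
    then show ?thesis
      by (simp only:) (rule finite_measure_Union, auto)
  qed
  ultimately show ?thesis
    using pos by (simp add: cond_prob_def field_simps)
qed

lemma up_prob_bounds:
  assumes "\<And>j. j \<ge> 1 \<Longrightarrow> \<bar>p j\<bar> < 1 / 2"
  shows "0 < up_prob p x" "up_prob p x \<le> 1" "x \<ge> 1 \<Longrightarrow> up_prob p x < 1"
  using assms[of x] by (auto simp: up_prob_def abs_if split: if_splits)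

text \<open>The path \<open>0, 1, ..., i\<close> that only steps up has positive
  probability.\<close>

lemma nearest_neighbour_walk_visits:
  assumes walk: "nearest_neighbour_walk p M X"
    and p: "\<And>j. j \<ge> 1 \<Longrightarrow> \<bar>p j\<bar> < 1 / 2"
  shows "visited_state M X i"
proof -
  have mc: "markov_chain M X (nn_transition p)" and X0: "AE \<omega> in M. X 0 \<omega> = 0"
    using walk by (auto simp: nearest_neighbour_walk_def)
  interpret prob_space M using mc by (simp add: markov_chain_def)
  note [measurable] = markov_chain_measurable[OF mc]
  have "\<P>(\<omega> in M. \<forall>k\<le>n. X k \<omega> = k) > 0" for n
  proof (induction n)
    case 0
    have "\<P>(\<omega> in M. X 0 \<omega> = 0) = 1"
      using X0 by (subst prob_Collect_eq_1) auto
    then show ?case by simp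
  next
    case (Suc n)
    have "(\<forall>k\<le>Suc n. X k \<omega> = k) \<longleftrightarrow> (\<forall>k\<le>n. X k \<omega> = k) \<and> X (Suc n) \<omega> = Suc n" for \<omega>
      by (auto simp: le_Suc_eq)
    moreover have "nn_transition p n (Suc n) > 0"
      using up_prob_bounds[OF p] by (simp add: nn_transition_def)
    ultimately show ?case
      using markov_chain_step[OF mc, of n "\<lambda>k. k" "Suc n"] Suc.IH by simp
  qed
  from this[of i] have "0 < \<P>(\<omega> in M. \<forall>k\<le>i. X k \<omega> = k)" .
  also have "\<dots> \<le> \<P>(\<omega> in M. X i \<omega> = i)"
    by (intro finite_measure_mono) auto
  finally show ?thesis
    unfolding visited_state_def by blast
qed

section \<open>Recurrence and transience through the scale density\<close>

definition scale_density :: "(nat \<Rightarrow> real) \<Rightarrow> nat \<Rightarrow> real" where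
  "scale_density p n = (\<Prod>j=1..n. (1 - up_prob p j) / up_prob p j)"

text \<open>When \<open>up_prob p (Suc n)\<close> is nonzero, this is the balance between upward and
  downward increments that makes a function with increments \<open>scale_density p\<close> harmonic
  at \<open>Suc n\<close>.\<close>

lemma scale_density_Suc:
  "scale_density p (Suc n) = (1 - up_prob p (Suc n)) / up_prob p (Suc n) * scale_density p n"
  by (simp add: scale_density_def)

lemma scale_density_pos:
  assumes "\<And>j. j \<ge> 1 \<Longrightarrow> \<bar>p j\<bar> < 1 / 2"
  shows "scale_density p n > 0"
  unfolding scale_density_def using up_prob_bounds[of p] assms by (intro prod_pos) simp

lemma avoid_prob_nonneg:
  assumes "\<And>j. j \<ge> 1 \<Longrightarrow> \<bar>p j\<bar> < 1 / 2"
  shows "0 \<le> avoid_prob p i n x"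
proof (induction n arbitrary: x)
  case (Suc n)
  have "0 < up_prob p x" "up_prob p x \<le> 1"
    using up_prob_bounds[of p x] assms by auto
  then show ?case
    unfolding avoid_prob.simps using Suc by (intro add_nonneg_nonneg mult_nonneg_nonneg) auto
qed simp

text \<open>Longer windows are harder to avoid: the sequence decreases, an inequality that the
  one-step recursion preserves because its weights are nonnegative.\<close>

lemma avoid_prob_converges:
  assumes p: "\<And>j. j \<ge> 1 \<Longrightarrow> \<bar>p j\<bar> < 1 / 2"
  obtains r where "\<And>x. (\<lambda>n. avoid_prob p i n x) \<longlonglongrightarrow> r x" "\<And>x. 0 \<le> r x" "\<And>x. r x \<le> 1"
proof -
  note E = up_prob_bounds[of p, OF p]
  note nonneg = avoid_prob_nonneg[of p, OF p]
  have dec: "avoid_prob p i (Suc n) x \<le> avoid_prob p i n x" for n x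
  proof (induction n arbitrary: x)
    case 0
    have "avoid_prob p i (Suc 0) x \<le> up_prob p x * 1 + (1 - up_prob p x) * 1"
      unfolding avoid_prob.simps using E[of x] by (intro add_mono mult_left_mono) auto
    then show ?case by simp
  next
    case (Suc n)
    show ?case
      unfolding avoid_prob.simps(2)[of p i "Suc n"] avoid_prob.simps(2)[of p i n x]
      using E[of x] Suc by (intro add_mono mult_left_mono) (auto simp del: avoid_prob.simps)
  qed
  have decseq: "decseq (\<lambda>n. avoid_prob p i n x)" for x
    using dec by (intro decseq_SucI)
  have "\<exists>r. (\<lambda>n. avoid_prob p i n x) \<longlonglongrightarrow> r" for x
    using decseq_convergent[OF decseq, of 0] nonneg by metis
  then obtain r where r: "\<And>x. (\<lambda>n. avoid_prob p i n x) \<longlonglongrightarrow> r x"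
    by metis
  moreover have "0 \<le> r x" for x
    using nonneg by (intro LIMSEQ_le_const[OF r]) auto
  moreover have "r x \<le> 1" for x
    using decseq_ge[OF decseq r, of x 0] by simp
  ultimately show ?thesis ..
qed

text \<open>The limit of the avoidance probabilities, set to \<open>0\<close> at the target \<open>i\<close>, is a bounded function
  harmonic off \<open>i\<close>; above \<open>i\<close> its increments are proportional to \<open>scale_density p\<close>, below \<open>i\<close> it is constant.\<close>

lemma avoid_prob_tendsto_0:
  assumes p: "\<And>j. j \<ge> 1 \<Longrightarrow> \<bar>p j\<bar> < 1 / 2"
    and div: "\<not> summable (scale_density p)"
  shows "(\<lambda>n. avoid_prob p i n i) \<longlonglongrightarrow> 0"
proof -
  note E = up_prob_bounds[of p, OF p]
  note \<rho> = scale_density_pos[of p, OF p]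
  obtain r where r: "\<And>x. (\<lambda>n. avoid_prob p i n x) \<longlonglongrightarrow> r x"
      and r0: "\<And>x. 0 \<le> r x" and r1: "\<And>x. r x \<le> 1"
    using avoid_prob_converges[of p i, OF p] by metis
  define v where "v x = (if x = i then 0 else r x)" for x
  have v0: "0 \<le> v x" and v1: "v x \<le> 1" for x
    using r0 r1 by (auto simp: v_def)
  \<comment> \<open>This also holds at \<open>x = i\<close>, where \<open>v i = 0\<close> but
    \<open>r i\<close> is the limit sought; it yields \<open>r i\<close> once \<open>v\<close> is
    known to vanish next to \<open>i\<close>.\<close>
  have rv: "r x = up_prob p x * v (Suc x) + (1 - up_prob p x) * v (x - 1)" for x
  proof -
    have "(\<lambda>n. avoid_prob p i (Suc n) x) \<longlonglongrightarrow> up_prob p x * v (Suc x) + (1 - up_prob p x) * v (x - 1)"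
      unfolding avoid_prob.simps v_def by (intro tendsto_intros) (auto intro: r)
    with LIMSEQ_Suc[OF r] show ?thesis by (rule LIMSEQ_unique)
  qed
  have harmonic: "up_prob p x * (v (Suc x) - v x) = (1 - up_prob p x) * (v x - v (x - 1))" if "x \<noteq> i" for x
    using rv[of x] that by (simp add: v_def[of x] algebra_simps)
  \<comment> \<open>From \<open>0\<close> the walk surely steps up, so the increment of
    \<open>v\<close> at \<open>0\<close> is zero, and harmonicity passes this on up to
    \<open>i\<close>, where \<open>v\<close> is \<open>0\<close>.\<close>
  have below: "v x = 0" if "x \<le> i" for x
  proof -
    have "v (Suc y) = v y" if "y < i" for y
      using that
    proof (induction y)
      case 0
      then show ?case using harmonic[of 0] by (simp add: up_prob_def)
    next
      case (Suc y)
      then show ?case using harmonic[of "Suc y"] E(1)[of "Suc y"] by simp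
    qed
    with that show ?thesis
      by (induction x rule: inc_induct) (auto simp: v_def)
  qed
  define d where "d = (v (Suc i) - v i) / scale_density p i"
  have incr: "v (Suc x) - v x = d * scale_density p x" if "x \<ge> i" for x
    using that
  proof (induction x rule: dec_induct)
    case base
    show ?case using \<rho>[of i] by (simp add: d_def)
  next
    case (step x)
    then show ?case
      using harmonic[of "Suc x"] E(1)[of "Suc x"] by (simp add: scale_density_Suc field_simps)
  qed
  have above: "v x = d * sum (scale_density p) {i..<x}" if "x \<ge> i" for x
    using that
  proof (induction x rule: dec_induct)
    case base
    show ?case by (simp add: v_def)
  next
    case (step x)
    then show ?case using incr[of x] by (simp add: algebra_simps)
  qed
  \<comment> \<open>For \<open>d > 0\<close> the bound \<open>v \<le> 1\<close> would keep the sums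
    of the scale density from \<open>i\<close> on below \<open>1 / d\<close>, against
    divergence.\<close>
  have "d = 0"
  proof (rule ccontr)
    assume "d \<noteq> 0"
    moreover have "d \<ge> 0"
      using v0[of "Suc i"] \<rho>[of i] by (simp add: d_def v_def)
    ultimately have "d > 0" by simp
    have "sum (scale_density p) {..<n} \<le> sum (scale_density p) {..<i} + 1 / d" for n
    proof (cases "i \<le> n")
      case True
      then have "sum (scale_density p) {..<n} = sum (scale_density p) {..<i} + sum (scale_density p) {i..<n}"
        by (subst sum.union_disjoint[symmetric]) (auto intro: arg_cong2[where f=sum])
      moreover have "sum (scale_density p) {i..<n} \<le> 1 / d"
        using above[OF True] v1[of n] \<open>d > 0\<close> by (simp add: field_simps)
      ultimately show ?thesis by simp
    next
      case False
      then have "sum (scale_density p) {..<n} \<le> sum (scale_density p) {..<i}"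
        using \<rho> by (intro sum_mono2) (auto intro: less_imp_le)
      then show ?thesis using \<open>d > 0\<close> by (smt (verit) divide_pos_pos)
    qed
    then have "summable (scale_density p)"
      using \<rho> by (intro summableI_nonneg_bounded[of "scale_density p"]) (auto intro: less_imp_le)
    with div show False ..
  qed
  then have "v (Suc i) = 0"
    using above[of "Suc i"] by simp
  moreover have "v (i - 1) = 0"
    by (rule below) simp
  ultimately have "r i = 0"
    using rv[of i] by simp
  with r[of i] show ?thesis by simp
qed

text \<open>The normalised scale function \<open>w\<close> is harmonic above \<open>i\<close>, zero
  at \<open>i\<close> and at most \<open>1\<close>; induction on the horizon keeps it below the
  avoidance probabilities.\<close>

lemma avoid_prob_bounded_below:
  assumes p: "\<And>j. j \<ge> 1 \<Longrightarrow> \<bar>p j\<bar> < 1 / 2"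
    and sm: "summable (scale_density p)"
  obtains c where "c > 0" "\<And>n. avoid_prob p i n i \<ge> c"
proof -
  note E = up_prob_bounds[of p, OF p]
  note \<rho> = scale_density_pos[of p, OF p]
  define S where "S = suminf (scale_density p)"
  have S: "S > 0"
    unfolding S_def using sm \<rho> by (rule suminf_pos)
  \<comment> \<open>Dividing by the whole sum \<open>S\<close> gives \<open>w \<le> 1\<close>, which
    starts the induction because \<open>avoid_prob\<close> is \<open>1\<close> at horizon
    \<open>0\<close>.\<close>
  define w where "w x = sum (scale_density p) {i..<x} / S" for x
  have w1: "w x \<le> 1" for x
  proof -
    have "sum (scale_density p) {i..<x} \<le> S"
      unfolding S_def using sm by (intro sum_le_suminf) (auto intro: less_imp_le \<rho>)
    then show ?thesis using S by (simp add: w_def)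
  qed
  have step: "w (Suc x) = w x + scale_density p x / S" if "x \<ge> i" for x
    using that by (simp add: w_def add_divide_distrib)
  have wi: "w i = 0" by (simp add: w_def)
  have below: "w x \<le> avoid_prob p i n x" if "x > i" for x n
    using that
  proof (induction n arbitrary: x)
    case 0
    show ?case using w1 by simp
  next
    case (Suc n)
    then obtain y where y: "x = Suc y" "i \<le> y"
      by (cases x) auto
    have bal: "up_prob p x * (scale_density p x / S) = (1 - up_prob p x) * (scale_density p y / S)"
      using y(1) E(1)[of x] by (simp add: scale_density_Suc)
    have "w (Suc x) = w x + scale_density p x / S" "w y = w x - scale_density p y / S"
      using step[of y] step[of x] y by simp_all
    then have "up_prob p x * w (Suc x) + (1 - up_prob p x) * w y = w x +
        (up_prob p x * (scale_density p x / S) - (1 - up_prob p x) * (scale_density p y / S))"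
      by (simp only: ring_distribs)
    then have "w x = up_prob p x * w (Suc x) + (1 - up_prob p x) * w y"
      using bal by simp
    \<comment> \<open>If \<open>y = i\<close>, the recursion has a \<open>0\<close> in place of the
      avoidance probability, matched by \<open>w i = 0\<close>.\<close>
    also have "\<dots> \<le> avoid_prob p i (Suc n) x"
      unfolding avoid_prob.simps using Suc.IH[of "Suc x"] Suc.IH[of y] y wi E[of x]
      by (intro add_mono mult_left_mono) auto
    finally show ?case .
  qed
  \<comment> \<open>The \<open>1\<close> serves horizon \<open>0\<close>; at longer horizons the
    first step up from \<open>i\<close> alone contributes at least the other term.\<close>
  define c where "c = min 1 (up_prob p i * w (Suc i))"
  have "c > 0"
    using E(1)[of i] step[of i] wi \<rho>[of i] S by (simp add: c_def)
  moreover have "avoid_prob p i n i \<ge> c" for n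
  proof (cases n)
    case (Suc k)
    have "0 \<le> avoid_prob p i m x" for m x
      by (rule avoid_prob_nonneg[of p, OF p])
    moreover have "up_prob p i * w (Suc i) \<le> up_prob p i * avoid_prob p i k (Suc i)"
      using below[of "Suc i" k] E(1)[of i] by simp
    ultimately show ?thesis
      using E(2)[of i] unfolding Suc by (auto simp: c_def min_le_iff_disj intro: add_increasing2)
  qed (simp add: c_def)
  ultimately show ?thesis ..
qed

theorem nearest_neighbour_walk_recurrent:
  assumes walk: "nearest_neighbour_walk p M X"
    and p: "\<And>j. j \<ge> 1 \<Longrightarrow> \<bar>p j\<bar> < 1 / 2"
    and div: "\<not> summable (scale_density p)"
  shows "recurrent_chain M X"
  unfolding recurrent_chain_def recurrent_state_def
proof (intro allI conjI impI)
  fix i m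
  show "visited_state M X i"
    using nearest_neighbour_walk_visits[OF walk p] .
  assume "\<P>(\<omega> in M. X m \<omega> = i) > 0"
  then show "\<P>(\<omega> in M. \<exists>n>m. X n \<omega> = i \<bar> X m \<omega> = i) = 1"
    using return_prob[of M X p m i 0] avoid_prob_tendsto_0[of p i, OF p div] walk
    by (simp add: nearest_neighbour_walk_def)
qed

theorem nearest_neighbour_walk_transient:
  assumes walk: "nearest_neighbour_walk p M X"
    and p: "\<And>j. j \<ge> 1 \<Longrightarrow> \<bar>p j\<bar> < 1 / 2"
    and sm: "summable (scale_density p)"
  shows "transient_chain M X"
  unfolding transient_chain_def transient_state_def
proof (intro allI conjI impI)
  fix i m
  show "visited_state M X i"
    using nearest_neighbour_walk_visits[OF walk p] .
  assume pos: "\<P>(\<omega> in M. X m \<omega> = i) > 0"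
  obtain r where r: "\<And>x. (\<lambda>n. avoid_prob p i n x) \<longlonglongrightarrow> r x"
    using avoid_prob_converges[of p i, OF p] by metis
  obtain c where "c > 0" and c: "\<And>n. avoid_prob p i n i \<ge> c"
    using avoid_prob_bounded_below[of p i, OF p sm] by metis
  have "c \<le> r i"
    using c by (intro LIMSEQ_le_const[OF r]) auto
  then show "\<P>(\<omega> in M. \<exists>n>m. X n \<omega> = i \<bar> X m \<omega> = i) < 1"
    using return_prob[of M X p m i, OF _ pos r] walk \<open>c > 0\<close> by (simp add: nearest_neighbour_walk_def)
qed

section \<open>Iterated logarithms\<close>

lemma lam_Suc: "lam (Suc k) x = lam k x * ilog k x"
  by (cases k) simp_all

lemma ilog_defined_le: "ilog_defined K x \<Longrightarrow> k \<le> K \<Longrightarrow> ilog_defined k x"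
  by (induction K) (auto simp: le_Suc_eq)

lemma ilog_mono:
  assumes "ilog_defined k x" "x \<le> y"
  shows "ilog_defined k y" "ilog k x \<le> ilog k y"
proof -
  have "ilog_defined k y \<and> ilog k x \<le> ilog k y"
    using assms by (induction k) (auto simp: less_le_trans)
  then show "ilog_defined k y" "ilog k x \<le> ilog k y" by auto
qed

lemma lam_pos: "ilog_defined k x \<Longrightarrow> 0 < lam k x"
  by (induction k) (auto simp: lam_Suc)

lemma lam_mono: "ilog_defined k x \<Longrightarrow> x \<le> y \<Longrightarrow> lam k x \<le> lam k y"
proof (induction k)
  case (Suc k)
  then show ?case
    using lam_pos[of k x] ilog_mono[of k x y] unfolding lam_Suc by (intro mult_mono) auto
qed simp

lemma DERIV_ilog: "ilog_defined k x \<Longrightarrow> (ilog k has_real_derivative 1 / lam k x) (at x)"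
proof (induction k)
  case 0
  have "ilog 0 = (\<lambda>x. x)" by auto
  then show ?case by simp
next
  case (Suc k)
  have "((\<lambda>x. ln (ilog k x)) has_real_derivative 1 / ilog k x * (1 / lam k x)) (at x)"
    using Suc by (intro DERIV_chain2[OF DERIV_ln_divide]) auto
  moreover have "ilog (Suc k) = (\<lambda>x. ln (ilog k x))" by auto
  ultimately show ?case by (simp add: lam_Suc mult.commute)
qed

text \<open>Exponentiating lowers each index by one: the sum over \<open>1, ..., k\<close> becomes
  the product of the iterated logarithms \<open>0, ..., k - 1\<close>.\<close>

lemma exp_sum_ilog: "ilog_defined k x \<Longrightarrow> exp (\<Sum>j=1..k. ilog j x) = lam k x"
  by (induction k) (auto simp: exp_add lam_Suc)

lemma filterlim_ilog: "filterlim (ilog k) at_top at_top"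
proof (induction k)
  case 0
  have "ilog 0 = (\<lambda>x. x)" by auto
  then show ?case by (simp add: filterlim_ident)
next
  case (Suc k)
  have "ilog (Suc k) = (\<lambda>x. ln (ilog k x))" by auto
  then show ?case using filterlim_compose[OF ln_at_top Suc] by simp
qed

lemma eventually_ilog_defined: "eventually (ilog_defined k) at_top"
proof (induction k)
  case (Suc k)
  have "eventually (\<lambda>x. 0 < ilog k x) at_top"
    using filterlim_ilog[of k] by (simp add: filterlim_at_top_dense)
  with Suc show ?case by eventually_elim simp
qed simp

lemma eventually_le_lam: "eventually (\<lambda>x. x \<le> lam (Suc k) x) at_top"
proof (induction k)
  case (Suc k)
  have "eventually (\<lambda>x. 1 \<le> ilog (Suc k) x) at_top"
    using filterlim_ilog[of "Suc k"] by (simp only: filterlim_at_top)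
  with Suc eventually_ge_at_top[of 0] show ?case
  proof eventually_elim
    case (elim x)
    then have "x * 1 \<le> lam (Suc k) x * ilog (Suc k) x"
      by (intro mult_mono) auto
    then show ?case by (simp only: lam_Suc[of "Suc k"] mult_1_right)
  qed
qed simp

section \<open>Size and monotonicity of the drift\<close>

lemma LamB_pos:
  assumes "ilog_defined K x" "B > 0"
  shows "0 < LamB K x B"
proof -
  have "0 \<le> Lam (K - 1) x"
    unfolding Lam_def using assms
    by (intro sum_nonneg) (auto intro!: less_imp_le lam_pos ilog_defined_le[of K])
  then show ?thesis
    using assms lam_pos[of K x] by (auto simp: LamB_def intro: add_nonneg_pos)
qed

lemma LamB_antimono:
  assumes "ilog_defined K x" "x \<le> y" "B > 0"
  shows "LamB K y B \<le> LamB K x B"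
proof -
  have "c / lam k y \<le> c / lam k x" if "k \<le> K" "c > 0" for k c
    using that assms lam_pos[of k x] lam_mono[of k x y] ilog_defined_le[of K x k]
    by (intro divide_left_mono) auto
  then show ?thesis
    unfolding LamB_def Lam_def using assms by (intro add_mono sum_mono) auto
qed

text \<open>A bound of order \<open>1 / x\<close> has a summable square, which later absorbs the
  second-order errors of the logarithm.\<close>

lemma eventually_LamB_le:
  assumes "B > 0" "K \<ge> 1"
  shows "eventually (\<lambda>x. LamB K x B \<le> (real (K - 1) + B) / x) at_top"
proof -
  have "eventually (\<lambda>x. x \<le> lam k x) at_top" if "k \<in> {1..K}" for k
    using eventually_le_lam[of "k - 1"] that by simp
  then have "eventually (\<lambda>x. \<forall>k\<in>{1..K}. x \<le> lam k x) at_top"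
    by (intro eventually_ball_finite) auto
  with eventually_gt_at_top[of 0] show ?thesis
  proof eventually_elim
    case (elim x)
    then have "c / lam k x \<le> c / x" if "k \<in> {1..K}" "c > 0" for c k
      using that by (intro frac_le) auto
    then have "LamB K x B \<le> (\<Sum>k=1..K - 1. 1 / x) + B / x"
      unfolding LamB_def Lam_def using assms by (intro add_mono sum_mono) auto
    then show ?case by (simp add: add_divide_distrib)
  qed
qed

lemma tendsto_LamB:
  assumes "B > 0" "K \<ge> 1"
  shows "((\<lambda>x. LamB K x B) \<longlongrightarrow> 0) at_top"
proof (rule tendsto_sandwich[OF _ eventually_LamB_le[OF assms]])
  show "eventually (\<lambda>x. 0 \<le> LamB K x B) at_top"
    using eventually_ilog_defined[of K]
    by eventually_elim (use assms in \<open>auto intro: less_imp_le LamB_pos\<close>)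
  show "((\<lambda>x. (real (K - 1) + B) / x) \<longlongrightarrow> 0) at_top"
    by (intro tendsto_divide_0[OF tendsto_const] filterlim_at_top_imp_at_infinity filterlim_ident)
qed simp

lemma eventually_real_nat: "eventually P (at_top :: real filter) \<Longrightarrow> eventually (\<lambda>n. P (real n)) sequentially"
  using filterlim_real_sequentially by (simp add: filterlim_iff)

text \<open>The least index exists because \<open>LamB K x B\<close> tends to \<open>0\<close>.
  Definedness and positivity of \<open>ilog (K - 1)\<close> together amount to
  \<open>ilog_defined K\<close>.\<close>

lemma start_index:
  assumes "B > 0" "K \<ge> 1"
  shows "ilog_defined K (real (start_index K B))" "LamB K (real (start_index K B)) B < 2"
proof -
  let ?P = "\<lambda>x::real. 1 \<le> x \<and> ilog_defined K x \<and> LamB K x B < 2"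
  have "eventually ?P at_top"
    using eventually_ge_at_top[of 1] eventually_ilog_defined[of K]
      order_tendstoD(2)[OF tendsto_LamB[OF assms], of 2, simplified]
    by eventually_elim auto
  then have "eventually (\<lambda>n. ?P (real n)) sequentially"
    by (rule eventually_real_nat)
  then obtain n where "?P (real n)"
    by (auto simp: eventually_sequentially)
  moreover obtain L where K: "K = Suc L" using assms(2) by (cases K) auto
  ultimately have "\<exists>i. i \<ge> 1 \<and> ilog_defined (K - 1) (real i) \<and> ilog (K - 1) (real i) > 0
      \<and> 1 / 4 * LamB K (real i) B < 1 / 2"
    by (intro exI[of _ n]) auto
  from LeastI_ex[OF this]
  have "ilog_defined (K - 1) (real (start_index K B)) \<and> ilog (K - 1) (real (start_index K B)) > 0
      \<and> 1 / 4 * LamB K (real (start_index K B)) B < 1 / 2"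
    unfolding start_index_def[symmetric] by blast
  then show "ilog_defined K (real (start_index K B))" "LamB K (real (start_index K B)) B < 2"
    using K by auto
qed

lemma iterlog_drift_bounds:
  assumes "B > 0" "K \<ge> 1"
  shows "\<bar>iterlog_drift K B j\<bar> < 1 / 2"
proof -
  let ?x = "real (max j (start_index K B))"
  have le: "real (start_index K B) \<le> ?x" by simp
  have "LamB K ?x B \<le> LamB K (real (start_index K B)) B"
    using start_index[OF assms] le assms by (intro LamB_antimono) auto
  moreover have "0 < LamB K ?x B"
    using start_index(1)[OF assms] le assms by (intro LamB_pos ilog_mono(1)[OF _ le]) auto
  ultimately show ?thesis
    using start_index(2)[OF assms] unfolding iterlog_drift_def by (simp add: abs_if)
qed

section \<open>The primitive of the drift and the scale density\<close>

definition PhiB :: "nat \<Rightarrow> real \<Rightarrow> real \<Rightarrow> real" where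
  "PhiB K B x = (\<Sum>k=1..K - 1. ilog k x) + B * ilog K x"

lemma DERIV_PhiB:
  assumes "ilog_defined K x"
  shows "(PhiB K B has_real_derivative LamB K x B) (at x)"
proof -
  have "((\<lambda>x. (\<Sum>k=1..K - 1. ilog k x) + B * ilog K x) has_real_derivative
      (\<Sum>k=1..K - 1. 1 / lam k x) + B * (1 / lam K x)) (at x)"
    using assms
    by (intro DERIV_add DERIV_sum DERIV_cmult DERIV_ilog) (auto intro: ilog_defined_le[of K])
  moreover have "PhiB K B = (\<lambda>x. (\<Sum>k=1..K - 1. ilog k x) + B * ilog K x)"
    by (auto simp: PhiB_def)
  ultimately show ?thesis
    by (simp add: LamB_def Lam_def)
qed

text \<open>Completing the sum by one copy of \<open>ilog K x\<close> splits off
  \<open>1 / lam K x\<close>, the derivative of \<open>ilog K\<close>.\<close>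

lemma exp_minus_PhiB:
  assumes "ilog_defined K x" "K \<ge> 1"
  shows "exp (- PhiB K B x) = exp ((1 - B) * ilog K x) / lam K x"
proof -
  obtain L where K: "K = Suc L" using assms(2) by (cases K) auto
  have "(\<Sum>k=1..K - 1. ilog k x) + ilog K x = (\<Sum>k=1..K. ilog k x)"
    by (simp add: K)
  then have "- PhiB K B x = (1 - B) * ilog K x - (\<Sum>k=1..K. ilog k x)"
    unfolding PhiB_def by (simp add: algebra_simps)
  then show ?thesis
    using exp_sum_ilog[OF assms(1)] by (simp add: exp_diff)
qed

lemma PhiB_mono:
  assumes "ilog_defined K x" "x \<le> y" "B > 0"
  shows "PhiB K B x \<le> PhiB K B y"
proof (rule DERIV_nonneg_imp_nondecreasing[OF assms(2)])
  fix z assume "x \<le> z" "z \<le> y"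
  then have "ilog_defined K z" using assms ilog_mono by blast
  then show "\<exists>D. (PhiB K B has_real_derivative D) (at z) \<and> 0 \<le> D"
    using DERIV_PhiB LamB_pos[of K z B] assms less_imp_le by blast
qed

text \<open>By the mean value theorem the increment is a value of the decreasing function
  \<open>LamB\<close> inside the unit interval.\<close>

lemma PhiB_increment:
  assumes "ilog_defined K x" "B > 0"
  shows "LamB K (x + 1) B \<le> PhiB K B (x + 1) - PhiB K B x"
    and "PhiB K B (x + 1) - PhiB K B x \<le> LamB K x B"
proof -
  have "\<exists>z>x. z < x + 1 \<and> PhiB K B (x + 1) - PhiB K B x = (x + 1 - x) * LamB K z B"
    using assms ilog_mono(1) by (intro MVT2 DERIV_PhiB) auto
  then obtain z where z: "x < z" "z < x + 1" "PhiB K B (x + 1) - PhiB K B x = LamB K z B"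
    by auto
  moreover have "ilog_defined K z" using z assms ilog_mono(1)[of K x z] by auto
  ultimately show "LamB K (x + 1) B \<le> PhiB K B (x + 1) - PhiB K B x"
    "PhiB K B (x + 1) - PhiB K B x \<le> LamB K x B"
    using assms LamB_antimono[of K z "x + 1" B] LamB_antimono[of K x z B] by auto
qed

text \<open>The sum \<open>a\<close> of the two terms stays bounded because its increments are
  dominated by the decrements of a nonnegative sequence \<open>g\<close>.\<close>

lemma scale_density_PhiB:
  assumes B: "B > 0" and K: "K \<ge> 1"
  obtains D where "eventually (\<lambda>n. \<bar>ln (scale_density (iterlog_drift K B) n) + PhiB K B (real n)\<bar> \<le> D) sequentially"
proof -
  let ?\<rho> = "scale_density (iterlog_drift K B)" and ?L = "\<lambda>n. LamB K (real n) B"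
  note \<rho> = scale_density_pos[of "iterlog_drift K B", OF iterlog_drift_bounds[OF B K]]
  define C where "C = real (K - 1) + B"
  define a where "a n = ln (?\<rho> n) + PhiB K B (real n)" for n
  \<comment> \<open>The first term pays for the second-order errors of the logarithm, the second for
    replacing \<open>LamB\<close> by increments of \<open>PhiB\<close>.\<close>
  define g where "g n = C\<^sup>2 / real n + ?L n" for n
  have "eventually (\<lambda>n. n \<ge> 1 \<and> n \<ge> start_index K B \<and> ilog_defined K (real n) \<and> ?L n \<le> C / real n \<and> ?L n < 1) sequentially"
    using eventually_ge_at_top[of 1] eventually_ge_at_top[of "start_index K B"]
      eventually_real_nat[OF eventually_ilog_defined[of K]]
      eventually_real_nat[OF eventually_LamB_le[OF B K]]
      eventually_real_nat[OF order_tendstoD(2)[OF tendsto_LamB[OF B K], of 1, simplified]]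
    unfolding C_def by eventually_elim auto
  then obtain N where N: "n \<ge> 1" "n \<ge> start_index K B" "ilog_defined K (real n)"
      "?L n \<le> C / real n" "?L n < 1" if "n \<ge> N" for n
    by (auto simp: eventually_sequentially)
  have step: "\<bar>a (Suc n) - a n\<bar> \<le> g n - g (Suc n)" if "n \<ge> N" for n
  proof -
    \<comment> \<open>Twice the drift, so that the new factor is \<open>(1 - y) / (1 + y)\<close>.
      From \<open>LamB < 1\<close> comes \<open>y < 1 / 2\<close>, as the bound
      \<open>2 * y\<^sup>2\<close> for each logarithm requires; the linear terms add up to
      \<open>- LamB\<close>.\<close>
    define y where "y = ?L (Suc n) / 2"
    have y: "0 < y" "y < 1 / 2" "y \<le> C / (2 * real (Suc n))"
      using LamB_pos[OF N(3) B, of "Suc n"] N[of "Suc n"] that by (auto simp: y_def field_simps)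
    have "up_prob (iterlog_drift K B) (Suc n) = (1 + y) / 2"
      using N(2)[of "Suc n"] that by (simp add: up_prob_def iterlog_drift_def y_def max_absorb1)
    then have "?\<rho> (Suc n) = (1 - y) / (1 + y) * ?\<rho> n"
    proof -
      assume E: "up_prob (iterlog_drift K B) (Suc n) = (1 + y) / 2"
      have "(1 - (1 + y) / 2) / ((1 + y) / 2) = (1 - y) / (1 + y)"
        using y by (simp add: field_simps)
      then show ?thesis by (simp only: scale_density_Suc E)
    qed
    then have "ln (?\<rho> (Suc n)) - ln (?\<rho> n) = ln (1 + (- y)) - ln (1 + y)"
      using y \<rho>[of n] by (simp add: ln_mult ln_div)
    moreover have "\<bar>ln (1 + (- y)) - (- y)\<bar> \<le> 2 * (- y)\<^sup>2" "\<bar>ln (1 + y) - y\<bar> \<le> 2 * y\<^sup>2"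
      using y by (intro abs_ln_one_plus_x_minus_x_bound; simp)+
    ultimately have ln_step: "\<bar>ln (?\<rho> (Suc n)) - ln (?\<rho> n) + ?L (Suc n)\<bar> \<le> 4 * y\<^sup>2"
      unfolding y_def by (simp add: abs_le_iff)
    have "4 * y\<^sup>2 = (2 * y)\<^sup>2" by (simp add: power2_eq_square)
    also have "\<dots> \<le> (C / real (Suc n))\<^sup>2"
      using y by (intro power_mono) (auto simp: field_simps)
    \<comment> \<open>Trading one factor \<open>Suc n\<close> for \<open>n\<close> makes the error
      telescope.\<close>
    also have "\<dots> \<le> C\<^sup>2 * (1 / (real n * real (Suc n)))"
      using N(1)[OF that] unfolding power_divide times_divide_eq_right mult_1_right
      by (intro divide_left_mono) (auto simp: power2_eq_square)
    also have "\<dots> = C\<^sup>2 / real n - C\<^sup>2 / real (Suc n)"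
      using N(1)[OF that] by (simp add: field_simps)
    finally have y2: "4 * y\<^sup>2 \<le> C\<^sup>2 / real n - C\<^sup>2 / real (Suc n)" .
    \<comment> \<open>The increment of \<open>a\<close> is the quantity in \<open>ln_step\<close>
      plus the increment of \<open>PhiB\<close> minus \<open>?L (Suc n)\<close>; the latter
      difference lies between \<open>0\<close> and \<open>?L n - ?L (Suc n)\<close>.\<close>
    have "real (Suc n) = real n + 1" by simp
    then show ?thesis
      using ln_step y2 PhiB_increment[OF N(3)[OF that] B]
      unfolding a_def g_def abs_le_iff by (simp only:) linarith
  qed
  have "\<bar>a n - a N\<bar> \<le> g N - g n" if "n \<ge> N" for n
    using that
  proof (induction n rule: dec_induct)
    case (step n)
    then show ?case using \<open>\<And>n. N \<le> n \<Longrightarrow> \<bar>a (Suc n) - a n\<bar> \<le> g n - g (Suc n)\<close>[of n] by linarith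
  qed simp
  moreover have "g n \<ge> 0" if "n \<ge> N" for n
    using LamB_pos[OF N(3)[OF that] B] by (simp add: g_def)
  ultimately have "\<bar>a n\<bar> \<le> \<bar>a N\<bar> + g N" if "n \<ge> N" for n
    using that by (smt (verit))
  then have "eventually (\<lambda>n. \<bar>a n\<bar> \<le> \<bar>a N\<bar> + g N) sequentially"
    by (auto simp: eventually_sequentially)
  then show ?thesis
    unfolding a_def by (rule that)
qed

section \<open>The comparison series: divergence for \<open>B \<le> 1\<close>, convergence for
  \<open>B > 1\<close>\<close>

lemma summable_scale_density_iff:
  assumes B: "B > 0" and K: "K \<ge> 1"
  shows "summable (scale_density (iterlog_drift K B)) \<longleftrightarrow> summable (\<lambda>n. exp (- PhiB K B (real n)))"
proof -
  let ?\<rho> = "scale_density (iterlog_drift K B)"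
  note \<rho> = scale_density_pos[of "iterlog_drift K B", OF iterlog_drift_bounds[OF B K]]
  obtain D where D: "eventually (\<lambda>n. \<bar>ln (?\<rho> n) + PhiB K B (real n)\<bar> \<le> D) sequentially"
    using scale_density_PhiB[OF B K] .
  have "eventually (\<lambda>n. norm (?\<rho> n) \<le> exp D * exp (- PhiB K B (real n))) sequentially"
    using D
  proof eventually_elim
    case (elim n)
    then have "exp (ln (?\<rho> n)) \<le> exp (D + - PhiB K B (real n))" by simp
    then show ?case using \<rho>[of n] by (simp only: exp_add exp_ln real_norm_def abs_of_pos)
  qed
  moreover have "eventually (\<lambda>n. norm (exp (- PhiB K B (real n))) \<le> exp D * ?\<rho> n) sequentially"
    using D
  proof eventually_elim
    case (elim n)
    then have "exp (- PhiB K B (real n)) \<le> exp (D + ln (?\<rho> n))" by simp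
    then show ?case using \<rho>[of n] by (simp only: exp_add exp_ln real_norm_def abs_exp_cancel)
  qed
  ultimately show ?thesis
    by (intro iffI) (rule summable_comparison_test_ev, assumption, erule summable_mult)+
qed

text \<open>For all \<open>B \<le> 1\<close> the terms eventually dominate \<open>1 / lam K\<close>,
  so partial sums dominate the increments of the unbounded \<open>ilog K\<close>.\<close>

lemma not_summable_exp_PhiB:
  assumes B: "0 < B" "B \<le> 1" and K: "K \<ge> 1"
  shows "\<not> summable (\<lambda>n. exp (- PhiB K B (real n)))"
proof
  let ?f = "\<lambda>n. exp (- PhiB K B (real n))"
  assume sm: "summable ?f"
  \<comment> \<open>One level more than the derivative needs: it supplies \<open>ilog K > 0\<close>,
    hence \<open>exp ((1 - B) * ilog K x) \<ge> 1\<close>.\<close>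
  have "eventually (ilog_defined (Suc K)) at_top"
    by (rule eventually_ilog_defined)
  from eventually_real_nat[OF this] obtain N where N: "ilog_defined (Suc K) (real n)" if "n \<ge> N" for n
    by (auto simp: eventually_sequentially)
  have step: "ilog K (real (Suc n)) - ilog K (real n) \<le> ?f n" if "n \<ge> N" for n
  proof -
    have dn: "ilog_defined K (real n)" using N[OF that] by simp
    have "\<exists>z>real n. z < real n + 1 \<and> ilog K (real n + 1) - ilog K (real n) = (real n + 1 - real n) * (1 / lam K z)"
      using dn ilog_mono(1) by (intro MVT2 DERIV_ilog) auto
    then obtain z where z: "real n < z" "ilog K (real n + 1) - ilog K (real n) = 1 / lam K z"
      by auto
    have "1 / lam K z \<le> 1 / lam K (real n)"
      using z dn lam_pos[OF dn] lam_mono[OF dn, of z] by (intro divide_left_mono) auto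
    also have "\<dots> \<le> exp ((1 - B) * ilog K (real n)) / lam K (real n)"
      using B N[OF that] lam_pos[OF dn] by (intro divide_right_mono) auto
    also have "\<dots> = ?f n"
      using exp_minus_PhiB[OF dn K] by simp
    finally show ?thesis using z by (simp add: add.commute)
  qed
  have "ilog K (real n) \<le> ilog K (real N) + suminf ?f" if "n \<ge> N" for n
  proof -
    have "ilog K (real n) - ilog K (real N) \<le> sum ?f {N..<n}"
      using that
    proof (induction n rule: dec_induct)
      case (step n)
      then show ?case
        using \<open>\<And>n. N \<le> n \<Longrightarrow> ilog K (real (Suc n)) - ilog K (real n) \<le> ?f n\<close>[of n] by simp
    qed simp
    also have "\<dots> \<le> suminf ?f"
      using sm by (intro sum_le_suminf) auto
    finally show ?thesis by simp
  qed
  then have "eventually (\<lambda>n. ilog K (real n) \<le> ilog K (real N) + suminf ?f) sequentially"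
    by (auto simp: eventually_sequentially)
  moreover have "filterlim (\<lambda>n. ilog K (real n)) at_top sequentially"
    by (rule filterlim_compose[OF filterlim_ilog filterlim_real_sequentially])
  then have "eventually (\<lambda>n. ilog K (real N) + suminf ?f < ilog K (real n)) sequentially"
    by (simp only: filterlim_at_top_dense)
  ultimately have "eventually (\<lambda>n::nat. False) sequentially"
    by eventually_elim simp
  then show False by simp
qed

lemma summable_exp_PhiB:
  assumes B: "B > 1" and K: "K \<ge> 1"
  shows "summable (\<lambda>n. exp (- PhiB K B (real n)))"
proof -
  let ?f = "\<lambda>n. exp (- PhiB K B (real n))"
  \<comment> \<open>Where \<open>ilog_defined K x\<close> holds, this is
    \<open>ilog (K - 1) x\<close> to the power \<open>1 - B\<close>, over \<open>B - 1\<close>. It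
    is nonnegative with derivative \<open>- exp (- PhiB K B x)\<close>, so its telescoping
    decrements are bounded in total.\<close>
  define G where "G x = exp ((1 - B) * ilog K x) / (B - 1)" for x
  from eventually_real_nat[OF eventually_ilog_defined[of K]]
  obtain N where N: "ilog_defined K (real n)" if "n \<ge> N" for n
    by (auto simp: eventually_sequentially)
  \<comment> \<open>The terms decrease, so the right endpoint lies below the mean value; hence the
    shift by \<open>Suc N\<close> at the end.\<close>
  have step: "?f (Suc n) \<le> G (real n) - G (real (Suc n))" if "n \<ge> N" for n
  proof -
    have dn: "ilog_defined K (real n)" using N[OF that] .
    have "(G has_real_derivative - exp (- PhiB K B x)) (at x)" if "ilog_defined K x" for x
    proof -
      have "(G has_real_derivative exp ((1 - B) * ilog K x) * ((1 - B) * (1 / lam K x)) / (B - 1)) (at x)"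
        unfolding G_def[abs_def]
        by (intro DERIV_cdivide DERIV_fun_exp DERIV_cmult DERIV_ilog that)
      also have "exp ((1 - B) * ilog K x) * ((1 - B) * (1 / lam K x)) / (B - 1) = - exp (- PhiB K B x)"
        unfolding exp_minus_PhiB[OF that K] using B lam_pos[OF that] by (simp add: field_simps)
      finally show ?thesis .
    qed
    then have "\<exists>z>real n. z < real n + 1 \<and>
        G (real n + 1) - G (real n) = (real n + 1 - real n) * - exp (- PhiB K B z)"
      using dn ilog_mono(1) by (intro MVT2) auto
    then obtain z where z: "real n < z" "z < real n + 1" "G (real n) - G (real n + 1) = exp (- PhiB K B z)"
      by (auto simp: algebra_simps)
    have "PhiB K B z \<le> PhiB K B (real n + 1)"
      using z B ilog_mono(1)[OF dn, of z] by (intro PhiB_mono) auto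
    with z show ?thesis by (simp add: add.commute)
  qed
  have "summable (\<lambda>n. ?f (Suc (n + N)))"
  proof (rule summableI_nonneg_bounded)
    fix n
    have "(\<Sum>k<n. ?f (Suc (k + N))) \<le> G (real N) - G (real (n + N))"
    proof (induction n)
      case (Suc n)
      then show ?case using step[of "n + N"] by simp
    qed simp
    also have "\<dots> \<le> G (real N)" using B by (simp add: G_def)
    finally show "(\<Sum>k<n. ?f (Suc (k + N))) \<le> G (real N)" .
  qed simp
  then show ?thesis
    using summable_iff_shift[of ?f "Suc N"] by simp
qed

theorem mainTheorem5:
  fixes K :: nat and B :: real
    and M :: "'a measure" and X :: "nat \<Rightarrow> 'a \<Rightarrow> nat"
  assumes "K \<ge> 1" and "B > 0"
    and "nearest_neighbour_walk (iterlog_drift K B) M X"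
  shows "(B \<le> 1 \<longrightarrow> recurrent_chain M X) \<and> (B > 1 \<longrightarrow> transient_chain M X)"
proof (intro conjI impI)
  note bounds = iterlog_drift_bounds[OF assms(2,1)]
    and iff = summable_scale_density_iff[OF assms(2,1)]
  show "recurrent_chain M X" if "B \<le> 1"
    using nearest_neighbour_walk_recurrent[OF assms(3) bounds]
      not_summable_exp_PhiB[OF assms(2) that assms(1)] iff by simp
  show "transient_chain M X" if "B > 1"
    using nearest_neighbour_walk_transient[OF assms(3) bounds]
      summable_exp_PhiB[OF that assms(1)] iff by simp
qed

end
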